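(* If a contact configuration $W$ satisfies $|W\cap R|=21$ for some root system $R$, then $W\subseteq R$ or $|W|\le22$.
   Context: A contact configuration is a finite set $W\subset S^3\subset\mathbb{R}^4$ of unit vectors with $\langle w,w'\rangle\le\frac12$ for all distinct $w,w'\in W$. Here a root system means the image under an orthogonal map of $\mathbb{R}^4$ of the set of $24$ normalised $D_4$ roots $(\pm e_i\pm e_j)/\sqrt2$, $1\le i<j\le4$. *)

theory Defs
  imports "HOL-Analysis.Analysis"
begin

definition contact_configuration :: "(real ^ 4) set \<Rightarrow> bool" where
  "contact_configuration W \<longleftrightarrow>
     finite W \<and> (\<forall>w\<in>W. norm w = 1) \<and>
     (\<forall>w\<in>W. \<forall>w'\<in>W. w \<noteq> w' \<longrightarrow> w \<bullet> w' \<le> 1 / 2)"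

(* The index type 4 carries a linear order, so i < j selects each unordered pair once;
   the vector axis i 1 is the standard basis vector e_i. *)
definition D4_roots :: "(real ^ 4) set" where
  "D4_roots =
     {(s *\<^sub>R axis i 1 + t *\<^sub>R axis j 1) /\<^sub>R sqrt 2 | s t i j.
        s \<in> {1, -1} \<and> t \<in> {1, -1} \<and> i < j}"

(* Narrower than the usual notion: only orthogonal images of the 24 normalised D4 roots. *)
definition root_system :: "(real ^ 4) set \<Rightarrow> bool" where
  "root_system R \<longleftrightarrow> (\<exists>f. orthogonal_transformation f \<and> R = f ` D4_roots)"

end

(* The argument works with frames: orthogonal bases a, b, c, d of vectors of length 1 / sqrt 2 such
   that R contains all vectors \<plusminus>u \<plusminus> v for distinct frame vectors u, v.  A unit vector x outside R
   has inner product > 1/2 with at least three roots; after a change of frame these include a + b,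
   a + c and a + d.  If x lies in W, then these three roots are absent from W, so they are exactly
   the three missing ones.  The remaining inequalities x \<bullet> r \<le> 1/2 then force x \<bullet> a > 1/2 and
   x \<bullet> b, x \<bullet> c, x \<bullet> d > 0, and the same holds for any other y in W - R, in the same frame.  Hence
   x \<bullet> y > 1/2, so W - R has at most one element. *)

theory Submission
  imports Defs
begin

section \<open>Frames of the root system and their symmetries\<close>

definition pair_in :: "'a::real_vector set \<Rightarrow> 'a \<Rightarrow> 'a \<Rightarrow> bool" where
  "pair_in R a b \<longleftrightarrow> a + b \<in> R \<and> a - b \<in> R \<and> - a + b \<in> R \<and> - a - b \<in> R"

text \<open>The factor 2 is the inverse of the squared length 1/2 of the frame vectors. The identity
  also encodes that the four vectors span: a vector orthogonal to all of them has square 0.\<close>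

definition parseval :: "'a::real_inner \<Rightarrow> 'a \<Rightarrow> 'a \<Rightarrow> 'a \<Rightarrow> bool" where
  "parseval a b c d \<longleftrightarrow> (\<forall>x y. x \<bullet> y =
     2 * ((x \<bullet> a) * (y \<bullet> a) + (x \<bullet> b) * (y \<bullet> b) + (x \<bullet> c) * (y \<bullet> c) + (x \<bullet> d) * (y \<bullet> d)))"

text \<open>Of \<open>R\<close> this records only that it contains the 24 vectors; the bound on its
  size comes separately from \<open>root_system_card\<close>.\<close>

definition D4_frame :: "'a::real_inner set \<Rightarrow> 'a \<Rightarrow> 'a \<Rightarrow> 'a \<Rightarrow> 'a \<Rightarrow> bool" where
  "D4_frame R a b c d \<longleftrightarrow>
     a \<bullet> a = 1/2 \<and> b \<bullet> b = 1/2 \<and> c \<bullet> c = 1/2 \<and> d \<bullet> d = 1/2 \<and>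
     a \<bullet> b = 0 \<and> a \<bullet> c = 0 \<and> a \<bullet> d = 0 \<and> b \<bullet> c = 0 \<and> b \<bullet> d = 0 \<and> c \<bullet> d = 0 \<and>
     parseval a b c d \<and>
     pair_in R a b \<and> pair_in R a c \<and> pair_in R a d \<and> pair_in R b c \<and> pair_in R b d \<and> pair_in R c d"

lemma pair_in_commute: "pair_in R a b \<Longrightarrow> pair_in R b a"
  unfolding pair_in_def by (auto simp: add.commute minus_diff_commute[of b a])

lemma pair_in_minus: "pair_in R a b \<Longrightarrow> pair_in R (- a) b"
  unfolding pair_in_def by (simp add: algebra_simps)

lemma parseval_swap12: "parseval a b c d = parseval b a c d"
  and parseval_swap23: "parseval a b c d = parseval a c b d"
  and parseval_swap34: "parseval a b c d = parseval a b d c"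
  unfolding parseval_def by (simp_all only: ac_simps)

text \<open>The three adjacent transpositions and \<open>D4_frame_minus\<close> generate all signed
  permutations of a frame.\<close>

lemma D4_frame_swap12: "D4_frame R a b c d \<Longrightarrow> D4_frame R b a c d"
  unfolding D4_frame_def parseval_swap12[of b] by (simp add: inner_commute pair_in_commute)

lemma D4_frame_swap23: "D4_frame R a b c d \<Longrightarrow> D4_frame R a c b d"
  unfolding D4_frame_def parseval_swap23[of a c] by (simp add: inner_commute pair_in_commute)

lemma D4_frame_swap34: "D4_frame R a b c d \<Longrightarrow> D4_frame R a b d c"
  unfolding D4_frame_def parseval_swap34[of a b d] by (simp add: inner_commute pair_in_commute)

lemma parseval_minus: "parseval (- a) b c d = parseval a b c d"
  unfolding parseval_def by (simp only: inner_minus_right minus_mult_minus)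

lemma D4_frame_minus: "D4_frame R a b c d \<Longrightarrow> D4_frame R (- a) b c d"
  unfolding D4_frame_def parseval_minus by (simp add: pair_in_minus)

text \<open>The triangle \<open>a + b\<close>, \<open>a + c\<close>, \<open>b + c\<close> is not conjugate to \<open>a + b\<close>, \<open>a + c\<close>, \<open>a + d\<close> under signed
  permutations of a frame.  This rotation, an automorphism of the root system outside that group,
  carries one to the other.\<close>

lemma D4_frame_hadamard:
  assumes "D4_frame R a b c d"
  shows "D4_frame R ((1/2) *\<^sub>R (a + b + c + d)) ((1/2) *\<^sub>R (a + b - c - d))
           ((1/2) *\<^sub>R (a - b + c - d)) ((1/2) *\<^sub>R (- a + b + c - d))"
proof -
  let ?p = "(1/2) *\<^sub>R (a + b + c + d)" and ?q = "(1/2) *\<^sub>R (a + b - c - d)"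
  let ?r = "(1/2) *\<^sub>R (a - b + c - d)" and ?s = "(1/2) *\<^sub>R (- a + b + c - d)"
  have half: "(1/2) *\<^sub>R v + (1/2) *\<^sub>R v = v" for v :: 'a
    by (metis scaleR_half_double scaleR_add_right)
  \<comment> \<open>The right-hand sides run through all sums and differences of two old frame
    vectors, up to sign, so both frames give the same 24 roots.\<close>
  have sums: "?p + ?q = a + b" "?p - ?q = c + d" "?p + ?r = a + c" "?p - ?r = b + d"
    "?p + ?s = b + c" "?p - ?s = a + d" "?q + ?r = a - d" "?q - ?r = b - c"
    "?q + ?s = b - d" "?q - ?s = a - c" "?r + ?s = c - d" "?r - ?s = a - b"
    using half[of a] half[of b] half[of c] half[of d]
    by (simp_all add: algebra_simps)
  \<comment> \<open>Membership is phrased through \<open>u + v\<close> and \<open>u - v\<close>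
    alone, so that \<open>sums\<close> can rewrite it.\<close>
  have neg: "pair_in R u v \<longleftrightarrow> u + v \<in> R \<and> u - v \<in> R \<and> - (u - v) \<in> R \<and> - (u + v) \<in> R" for u v
    unfolding pair_in_def by (simp add: algebra_simps)
  have par: "x \<bullet> y = 2 * ((x \<bullet> a) * (y \<bullet> a) + (x \<bullet> b) * (y \<bullet> b) + (x \<bullet> c) * (y \<bullet> c) + (x \<bullet> d) * (y \<bullet> d))" for x y
    using assms unfolding D4_frame_def parseval_def by blast
  have par': "x \<bullet> y = 2 * ((x \<bullet> ?p) * (y \<bullet> ?p) + (x \<bullet> ?q) * (y \<bullet> ?q) + (x \<bullet> ?r) * (y \<bullet> ?r) + (x \<bullet> ?s) * (y \<bullet> ?s))" for x y
    unfolding par[of x y] inner_scaleR_right inner_add_right inner_diff_right inner_minus_right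
    by (simp add: field_simps)
  then have parseval: "parseval ?p ?q ?r ?s"
    unfolding parseval_def by blast
  have pairs: "pair_in R ?p ?q \<and> pair_in R ?p ?r \<and> pair_in R ?p ?s \<and> pair_in R ?q ?r \<and>
      pair_in R ?q ?s \<and> pair_in R ?r ?s"
    using assms unfolding D4_frame_def neg sums by (simp add: algebra_simps)
  have orth: "a \<bullet> a = 1/2" "b \<bullet> b = 1/2" "c \<bullet> c = 1/2" "d \<bullet> d = 1/2"
     "a \<bullet> b = 0" "a \<bullet> c = 0" "a \<bullet> d = 0" "b \<bullet> c = 0" "b \<bullet> d = 0" "c \<bullet> d = 0"
     "b \<bullet> a = 0" "c \<bullet> a = 0" "d \<bullet> a = 0" "c \<bullet> b = 0" "d \<bullet> b = 0" "d \<bullet> c = 0"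
    using assms unfolding D4_frame_def by (simp_all add: inner_commute)
  show ?thesis
    unfolding D4_frame_def
    using pairs parseval by (simp add: inner_add_left inner_add_right inner_diff_left inner_diff_right orth)
qed

section \<open>Sorting the coordinates of a point\<close>

text \<open>Insertion sort into decreasing order by adjacent transpositions: the sorted prefix grows
  from two to four entries, and each case split locates the place of the new entry.\<close>

lemma sort4:
  fixes k :: "'a \<Rightarrow> 'b::linorder"
  assumes "P a b c d"
    and 12: "\<And>a b c d. P a b c d \<Longrightarrow> P b a c d"
    and 23: "\<And>a b c d. P a b c d \<Longrightarrow> P a c b d"
    and 34: "\<And>a b c d. P a b c d \<Longrightarrow> P a b d c"
  obtains a' b' c' d' where "P a' b' c' d'" "k a' \<ge> k b'" "k b' \<ge> k c'" "k c' \<ge> k d'"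
proof -
  obtain a b where sorted2: "P a b c d" "k a \<ge> k b"
  proof (cases "k a \<ge> k b")
    case True
    then show ?thesis using that[OF assms(1)] by simp
  next
    case False
    then show ?thesis using that[OF 12[OF assms(1)]] by simp
  qed
  obtain a b c where sorted3: "P a b c d" "k a \<ge> k b" "k b \<ge> k c"
  proof -
    consider "k b \<ge> k c" | "k a \<ge> k c" "\<not> k b \<ge> k c" | "\<not> k a \<ge> k c"
      by blast
    then show ?thesis
    proof cases
      case 1
      then show ?thesis using that[OF sorted2(1)] sorted2(2) by simp
    next
      case 2
      then show ?thesis using that[OF 23[OF sorted2(1)]] by simp
    next
      case 3
      then show ?thesis using that[OF 12[OF 23[OF sorted2(1)]]] sorted2(2) by simp
    qed
  qed
  consider "k c \<ge> k d" | "k b \<ge> k d" "\<not> k c \<ge> k d" | "k a \<ge> k d" "\<not> k b \<ge> k d" | "\<not> k a \<ge> k d"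
    by blast
  then show ?thesis
  proof cases
    case 1
    then show ?thesis using that[OF sorted3(1)] sorted3 by simp
  next
    case 2
    then show ?thesis using that[OF 34[OF sorted3(1)]] sorted3 by simp
  next
    case 3
    then show ?thesis using that[OF 23[OF 34[OF sorted3(1)]]] sorted3 by simp
  next
    case 4
    then show ?thesis using that[OF 12[OF 23[OF 34[OF sorted3(1)]]]] sorted3 by simp
  qed
qed

lemma D4_frame_abs:
  assumes "D4_frame R a b c d"
  obtains a' where "D4_frame R a' b c d" "x \<bullet> a' \<ge> 0"
proof (cases "x \<bullet> a \<ge> 0")
  case True
  then show ?thesis using that[OF assms] by blast
next
  case False
  then show ?thesis using that[OF D4_frame_minus[OF assms]] by simp
qed

lemma D4_frame_sorted:
  assumes "D4_frame R a b c d"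
  obtains a b c d where "D4_frame R a b c d" "x \<bullet> a \<ge> x \<bullet> b" "x \<bullet> b \<ge> x \<bullet> c" "x \<bullet> c \<ge> x \<bullet> d" "x \<bullet> d \<ge> 0"
proof -
  \<comment> \<open>Sign changes act on the first vector only, so each vector in turn is moved to
    the front; the frame ends up reversed.\<close>
  obtain a where 1: "D4_frame R a b c d" "x \<bullet> a \<ge> 0"
    by (rule D4_frame_abs[OF assms])
  obtain b where 2: "D4_frame R b a c d" "x \<bullet> b \<ge> 0"
    by (rule D4_frame_abs[OF D4_frame_swap12[OF 1(1)]])
  obtain c where 3: "D4_frame R c b a d" "x \<bullet> c \<ge> 0"
    by (rule D4_frame_abs[OF D4_frame_swap12[OF D4_frame_swap23[OF 2(1)]]])
  obtain d where 4: "D4_frame R d c b a" "x \<bullet> d \<ge> 0"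
    by (rule D4_frame_abs[OF D4_frame_swap12[OF D4_frame_swap23[OF D4_frame_swap34[OF 3(1)]]]])
  \<comment> \<open>Nonnegativity is part of the predicate, so that sorting preserves it.\<close>
  let ?P = "\<lambda>a b c d. D4_frame R a b c d \<and> x \<bullet> a \<ge> 0 \<and> x \<bullet> b \<ge> 0 \<and> x \<bullet> c \<ge> 0 \<and> x \<bullet> d \<ge> 0"
  have start: "?P d c b a" using 1 2 3 4 by simp
  obtain a b c d where "?P a b c d" "x \<bullet> a \<ge> x \<bullet> b" "x \<bullet> b \<ge> x \<bullet> c" "x \<bullet> c \<ge> x \<bullet> d"
  proof (rule sort4[where P = ?P and k = "\<lambda>v. x \<bullet> v", OF start])
    show "?P b a c d" if "?P a b c d" for a b c d
      using that D4_frame_swap12[of R a b c d] by blast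
    show "?P a c b d" if "?P a b c d" for a b c d
      using that D4_frame_swap23[of R a b c d] by blast
    show "?P a b d c" if "?P a b c d" for a b c d
      using that D4_frame_swap34[of R a b c d] by blast
  qed blast
  then show ?thesis using that by blast
qed

section \<open>Close roots and the coordinates they force\<close>

text \<open>The numbers are the coordinates of a unit vector in a sorted frame. If a conclusion
  fails, the bounds on the squares add up to at most 1/2, with equality only at (1/2, 1/2, 0, 0),
  the root \<open>a + b\<close>, which \<open>p + q \<noteq> 1\<close> excludes.\<close>

lemma sorted_coordinates:
  fixes p q r s :: real
  assumes "p \<ge> q" "q \<ge> r" "r \<ge> s" "s \<ge> 0" and sq: "p * p + q * q + r * r + s * s = 1/2"
    and ne: "p + q \<noteq> 1"
  shows "p + r > 1/2" "p + s > 1/2 \<or> q + r > 1/2"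
proof -
  have sq_le: "u * u \<le> v * v" if "0 \<le> u" "u \<le> v" for u v :: real
    using that by (simp add: mult_mono)
  have p: "p > 0"
  proof (rule ccontr)
    assume "\<not> p > 0"
    then have "p = 0" "q = 0" "r = 0" "s = 0" using assms(1-4) by linarith+
    with sq show False by simp
  qed
  show "p + r > 1/2"
  proof (rule ccontr)
    assume "\<not> p + r > 1/2"
    then have r: "r \<le> 1/2 - p" "s \<le> 1/2 - p" "p \<le> 1/2" using assms by auto
    have "q * q \<le> p * p" "r * r \<le> (1/2 - p) * (1/2 - p)" "s * s \<le> (1/2 - p) * (1/2 - p)"
      using assms r by (auto intro!: sq_le)
    then have "1/2 \<le> 2 * (p * p) + 2 * ((1/2 - p) * (1/2 - p))" using sq by linarith
    then have "p * (1/2 - p) \<le> 0" by (simp add: algebra_simps)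
    then have "p = 1/2" using p r by (simp add: mult_le_0_iff)
    moreover from this have "r = 0" "s = 0" using r assms by auto
    ultimately have "q * q = (1/2) * (1/2)" using sq by (simp only:)
    then have "q = 1/2" using assms by (simp only: square_eq_iff) linarith
    with \<open>p = 1/2\<close> ne show False by simp
  qed
  show "p + s > 1/2 \<or> q + r > 1/2"
  proof (rule ccontr)
    assume "\<not> (p + s > 1/2 \<or> q + r > 1/2)"
    then have r: "r \<le> 1/2 - q" "s \<le> 1/2 - p" "p \<le> 1/2" "q \<le> 1/2" using assms by auto
    have "r * r \<le> (1/2 - q) * (1/2 - q)" "s * s \<le> (1/2 - p) * (1/2 - p)"
      using assms r by (auto intro!: sq_le)
    then have "p * (1/2 - p) + q * (1/2 - q) \<le> 0" using sq by (simp add: algebra_simps)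
    moreover have "p * (1/2 - p) \<ge> 0" "q * (1/2 - q) \<ge> 0" using assms p r by auto
    ultimately have "p * (1/2 - p) = 0" and q: "q * (1/2 - q) = 0" by linarith+
    then have p2: "p = 1/2" using p by simp
    from q have "q = 0 \<or> q = 1/2" by auto
    then show False
    proof
      assume "q = 0"
      then have "r = 0" "s = 0" using assms by auto
      with \<open>q = 0\<close> p2 sq show False by (simp only:)
    next
      assume "q = 1/2"
      with p2 ne show False by simp
    qed
  qed
qed

lemma three_close_roots:
  assumes "D4_frame R a0 b0 c0 d0" "norm x = 1" "x \<notin> R"
  obtains a b c d where "D4_frame R a b c d" "x \<bullet> (a + b) > 1/2" "x \<bullet> (a + c) > 1/2" "x \<bullet> (a + d) > 1/2"
proof -
  obtain a b c d where F: "D4_frame R a b c d"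
    and ord: "x \<bullet> a \<ge> x \<bullet> b" "x \<bullet> b \<ge> x \<bullet> c" "x \<bullet> c \<ge> x \<bullet> d" "x \<bullet> d \<ge> 0"
    using D4_frame_sorted assms(1) by blast
  have xx: "x \<bullet> x = 1" using assms(2) by (simp add: norm_eq_1)
  have orth: "a \<bullet> a = 1/2" "b \<bullet> b = 1/2" "a \<bullet> b = 0"
    and par: "x \<bullet> x = 2 * ((x \<bullet> a) * (x \<bullet> a) + (x \<bullet> b) * (x \<bullet> b) + (x \<bullet> c) * (x \<bullet> c) + (x \<bullet> d) * (x \<bullet> d))"
    and root: "a + b \<in> R"
    using F[unfolded D4_frame_def pair_in_def parseval_def] by blast+
  \<comment> \<open>Unit vectors with inner product 1 coincide, so \<open>x\<close> would be the
    root \<open>a + b\<close>.\<close>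
  have "x \<bullet> a + x \<bullet> b \<noteq> 1"
  proof
    assume "x \<bullet> a + x \<bullet> b = 1"
    then have "(x - (a + b)) \<bullet> (x - (a + b)) = 0"
      using xx orth by (simp add: inner_add_left inner_add_right inner_diff_left inner_diff_right inner_commute)
    then show False using root assms(3) by simp
  qed
  from sorted_coordinates[OF ord _ this] xx par
  have ac: "x \<bullet> a + x \<bullet> c > 1/2" and alt: "x \<bullet> a + x \<bullet> d > 1/2 \<or> x \<bullet> b + x \<bullet> c > 1/2" by auto
  from alt show ?thesis
  proof
    assume "x \<bullet> a + x \<bullet> d > 1/2"
    then show ?thesis using that[OF F] ac ord by (simp add: inner_add_right)
  next
    assume "x \<bullet> b + x \<bullet> c > 1/2"
    \<comment> \<open>In the rotated frame the first vector plus each of the others gives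
      \<open>a + b\<close>, \<open>a + c\<close> and \<open>b + c\<close>.\<close>
    then show ?thesis
      using that[OF D4_frame_hadamard[OF F]] ac ord
      by (simp add: inner_add_right inner_diff_right field_simps)
  qed
qed

text \<open>Since \<open>w * w \<le> u * v < 2 * (u * v)\<close>, the sum of squares stays below the
  square of \<open>u + v\<close>.\<close>

lemma square_sum_less:
  fixes u v w :: real
  assumes "w \<le> u" "w \<le> v" "0 < w" "u + v \<le> 1/2"
  shows "u * u + v * v + w * w < 1/4"
proof -
  have "w * w \<le> u * v" "0 < u * v" using assms by (auto intro: mult_mono)
  moreover have "(u + v) * (u + v) \<le> (1/2) * (1/2)" using assms by (intro mult_mono) auto
  ultimately show ?thesis by (simp add: algebra_simps)
qed

text \<open>Subtracting \<open>p - q \<le> 1/2\<close> from \<open>p + q > 1/2\<close> gives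
  \<open>q > 0\<close>, and likewise for \<open>r\<close> and \<open>s\<close>. Their squares then
  sum to less than 1/4, which leaves more than 1/4 for \<open>p * p\<close>.\<close>

lemma first_coordinate_large:
  fixes p q r s :: real
  assumes "p + q > 1/2" "p + r > 1/2" "p + s > 1/2" "p - q \<le> 1/2" "p - r \<le> 1/2" "p - s \<le> 1/2"
    and "q + r \<le> 1/2" "q + s \<le> 1/2" "r + s \<le> 1/2"
    and sq: "p * p + q * q + r * r + s * s = 1/2"
  shows "p > 1/2 \<and> q > 0 \<and> r > 0 \<and> s > 0"
proof -
  have pos: "q > 0" "r > 0" "s > 0" and p: "p > 0" using assms by auto
  \<comment> \<open>One instance for each choice of the least of the three; the first argument
    instantiates \<open>w\<close>, the first variable to occur in the lemma.\<close>
  have "q * q + r * r + s * s < 1/4"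
    using square_sum_less[of q r s] square_sum_less[of r q s] square_sum_less[of s q r] pos assms
    by linarith
  then have "(1/2) * (1/2) < p * p" using sq by linarith
  moreover have "p * p \<le> (1/2) * (1/2)" if "p \<le> 1/2"
    using p that by (intro mult_mono) auto
  ultimately have "p > 1/2" by linarith
  then show ?thesis using pos by simp
qed

lemma close_roots_imp_coordinates:
  assumes F: "D4_frame R a b c d" and "norm x = 1"
    and close: "{r \<in> R. x \<bullet> r > 1/2} = {a + b, a + c, a + d}"
  shows "x \<bullet> a > 1/2 \<and> x \<bullet> b > 0 \<and> x \<bullet> c > 0 \<and> x \<bullet> d > 0"
proof -
  have orth: "a \<bullet> a = 1/2" "b \<bullet> b = 1/2" "c \<bullet> c = 1/2" "d \<bullet> d = 1/2"
     "a \<bullet> b = 0" "a \<bullet> c = 0" "a \<bullet> d = 0" "b \<bullet> c = 0" "b \<bullet> d = 0" "c \<bullet> d = 0"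
     "b \<bullet> a = 0" "c \<bullet> a = 0" "d \<bullet> a = 0" "c \<bullet> b = 0" "d \<bullet> b = 0" "d \<bullet> c = 0"
    and parseval: "parseval a b c d"
    and roots: "a - b \<in> R" "a - c \<in> R" "a - d \<in> R" "b + c \<in> R" "b + d \<in> R" "c + d \<in> R"
    using F unfolding D4_frame_def pair_in_def by (simp_all add: inner_commute)
  \<comment> \<open>The test vector \<open>v\<close> certifies that \<open>r\<close> is none of the
    three close roots, by comparing inner products.\<close>
  have far: "x \<bullet> r \<le> 1/2"
    if "r \<in> R" "r \<bullet> v \<notin> {(a + b) \<bullet> v, (a + c) \<bullet> v, (a + d) \<bullet> v}" for r v
  proof (rule ccontr)
    assume "\<not> x \<bullet> r \<le> 1/2"
    with that(1) have "r \<in> {a + b, a + c, a + d}" unfolding close[symmetric] by simp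
    with that(2) show False by auto
  qed
  have "x \<bullet> (a - b) \<le> 1/2" "x \<bullet> (a - c) \<le> 1/2" "x \<bullet> (a - d) \<le> 1/2"
    using far[OF roots(1), of b] far[OF roots(2), of c] far[OF roots(3), of d]
    by (simp_all add: inner_add_left inner_diff_left orth)
  moreover have "x \<bullet> (b + c) \<le> 1/2" "x \<bullet> (b + d) \<le> 1/2" "x \<bullet> (c + d) \<le> 1/2"
    using far[OF roots(4), of a] far[OF roots(5), of a] far[OF roots(6), of a]
    by (simp_all add: inner_add_left orth)
  moreover have "r \<in> {a + b, a + c, a + d} \<Longrightarrow> x \<bullet> r > 1/2" for r
    unfolding close[symmetric] by simp
  then have "x \<bullet> (a + b) > 1/2" "x \<bullet> (a + c) > 1/2" "x \<bullet> (a + d) > 1/2"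
    by blast+
  moreover have "(x \<bullet> a) * (x \<bullet> a) + (x \<bullet> b) * (x \<bullet> b) + (x \<bullet> c) * (x \<bullet> c) + (x \<bullet> d) * (x \<bullet> d) = 1/2"
    using parseval[unfolded parseval_def, rule_format, of x x] assms(2) by (simp add: norm_eq_1)
  ultimately show ?thesis
    by (intro first_coordinate_large) (simp_all add: inner_add_right inner_diff_right)
qed

lemma D4_frame_roots_card:
  assumes F: "D4_frame R a b c d"
  shows "card {a + b, a + c, a + d} = 3"
proof -
  have "b \<bullet> b = 1/2" "c \<bullet> c = 1/2" "b \<bullet> c = 0" "b \<bullet> d = 0" "c \<bullet> d = 0"
    using F unfolding D4_frame_def by blast+
  then have "b \<noteq> c" "b \<noteq> d" "c \<noteq> d" by auto
  then show ?thesis by simp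
qed

section \<open>A frame for a root system, and its size\<close>

lemma root_system_D4_frame:
  assumes "root_system R"
  obtains a b c d where "D4_frame R a b c d"
proof -
  obtain f where f: "orthogonal_transformation f" and R: "R = f ` D4_roots"
    using assms unfolding root_system_def by blast
  let ?e = "\<lambda>i :: 4. f (axis i 1 /\<^sub>R sqrt 2)"
  have lin: "linear f" and inn: "f v \<bullet> f w = v \<bullet> w" for v w
    using f unfolding orthogonal_transformation_def by auto
  have root: "s *\<^sub>R ?e i + t *\<^sub>R ?e j \<in> R" if "s \<in> {1, -1}" "t \<in> {1, -1}" "i \<noteq> j" for s t i j
  proof -
    have "(s *\<^sub>R axis i 1 + t *\<^sub>R axis j 1) /\<^sub>R sqrt 2 \<in> D4_roots"
    proof (cases "i < j")
      case True
      then show ?thesis using that unfolding D4_roots_def by blast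
    next
      case False
      then have "j < i" using that by simp
      then show ?thesis using that unfolding D4_roots_def by (subst add.commute) blast
    qed
    then have "f ((s *\<^sub>R axis i 1 + t *\<^sub>R axis j 1) /\<^sub>R sqrt 2) \<in> R" unfolding R by blast
    then show ?thesis
      by (simp add: linear_add[OF lin] linear_scale[OF lin] scaleR_add_right mult.commute)
  qed
  have pair: "pair_in R (?e i) (?e j)" if "i \<noteq> j" for i j
    using root[of 1 1 i j] root[of 1 "-1" i j] root[of "-1" 1 i j] root[of "-1" "-1" i j] that
    unfolding pair_in_def by simp
  have orth: "?e i \<bullet> ?e j = (if i = j then 1/2 else 0)" for i j
    unfolding inn by (simp add: inner_axis_axis field_simps)
  have "x \<bullet> y = 2 * ((x \<bullet> ?e 1) * (y \<bullet> ?e 1) + (x \<bullet> ?e 2) * (y \<bullet> ?e 2) +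
      (x \<bullet> ?e 3) * (y \<bullet> ?e 3) + (x \<bullet> ?e 4) * (y \<bullet> ?e 4))" for x y
  proof -
    \<comment> \<open>Pulling back along \<open>f\<close> turns the claim into the coordinate
      formula for the standard inner product.\<close>
    obtain v w where "x = f v" "y = f w"
      using orthogonal_transformation_surj[OF f] by (metis surjD)
    then show ?thesis
      unfolding \<open>x = f v\<close> \<open>y = f w\<close> inn inner_scaleR_right inner_axis
      by (simp add: inner_vec_def sum_4 field_simps)
  qed
  then have "parseval (?e 1) (?e 2) (?e 3) (?e 4)"
    unfolding parseval_def by blast
  then have "D4_frame R (?e 1) (?e 2) (?e 3) (?e 4)"
    unfolding D4_frame_def by (simp add: orth pair)
  then show ?thesis by (rule that)
qed

text \<open>Two signs and six index pairs give 2 * 2 * 6 = 24 parameters, which bounds the size of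
  the image.\<close>

lemma root_system_card:
  assumes "root_system R"
  shows "finite R" "card R \<le> 24"
proof -
  obtain f where R: "R = f ` D4_roots"
    using assms unfolding root_system_def by blast
  let ?A = "{(i, j). i < j} :: (4 \<times> 4) set"
  let ?B = "{1, -1} \<times> {1, -1} \<times> ?A :: (real \<times> real \<times> 4 \<times> 4) set"
  let ?g = "\<lambda>(s, t, i, j). (s *\<^sub>R axis i 1 + t *\<^sub>R axis j 1) /\<^sub>R sqrt 2 :: real ^ 4"
  have "D4_roots \<subseteq> ?g ` ?B"
  proof
    fix v assume "v \<in> D4_roots"
    then obtain s t i j where "v = ?g (s, t, i, j)" "(s, t, i, j) \<in> ?B"
      unfolding D4_roots_def by auto
    then show "v \<in> ?g ` ?B" by (rule image_eqI)
  qed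
  then have sub: "R \<subseteq> (f \<circ> ?g) ` ?B"
    unfolding R image_comp[symmetric] by (rule image_mono)
  \<comment> \<open>Ordered pairs with \<open>i < j\<close> embed into the two-element subsets, of
    which there are 4 choose 2.\<close>
  have "inj_on (\<lambda>(i, j). {i, j}) ?A"
    by (auto simp: inj_on_def doubleton_eq_iff)
  then have "card ?A = card ((\<lambda>(i, j). {i, j}) ` ?A)"
    by (simp add: card_image)
  also have "\<dots> \<le> card {K. K \<subseteq> (UNIV :: 4 set) \<and> card K = 2}"
    by (rule card_mono) (auto simp: card_2_iff)
  also have "\<dots> = 6"
    by (subst n_subsets) (simp_all add: choose_two)
  finally have "card ?B \<le> 24"
    by (simp add: card_cartesian_product)
  moreover have fin: "finite ?B" by simp
  ultimately have "card ((f \<circ> ?g) ` ?B) \<le> 24"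
    by (meson card_image_le order_trans)
  moreover have "finite ((f \<circ> ?g) ` ?B)"
    using fin by (rule finite_imageI)
  ultimately show "finite R" "card R \<le> 24"
    using sub by (meson finite_subset card_mono order_trans)+
qed

section \<open>Counting missing roots and extra points\<close>

lemma at_most_one_extra_point:
  assumes W: "contact_configuration W" and R: "root_system R" and card: "card (W \<inter> R) = 21"
    and x: "x \<in> W - R" and y: "y \<in> W - R"
  shows "x = y"
proof (rule ccontr)
  assume "x \<noteq> y"
  have norms: "norm x = 1" "norm y = 1" and xy: "x \<bullet> y \<le> 1/2"
    using W x y \<open>x \<noteq> y\<close> unfolding contact_configuration_def by auto
  obtain a0 b0 c0 d0 where F0: "D4_frame R a0 b0 c0 d0"
    using root_system_D4_frame[OF R] by blast
  have finM: "finite (R - W)" using root_system_card[OF R] by simp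
  have "card (R - W) = card R - card (W \<inter> R)"
    using root_system_card[OF R] by (metis card_Diff_subset_Int finite_Int Int_commute)
  then have cardM: "card (R - W) \<le> 3"
    using root_system_card[OF R] card by simp
  have missing: "\<exists>a b c d. D4_frame R a b c d \<and> R - W = {a + b, a + c, a + d} \<and>
      {r \<in> R. z \<bullet> r > 1/2} = R - W" if z: "z \<in> W - R" for z
  proof -
    have "norm z = 1" "z \<notin> R" using W z unfolding contact_configuration_def by auto
    then obtain a b c d where F: "D4_frame R a b c d"
      and gt: "z \<bullet> (a + b) > 1/2" "z \<bullet> (a + c) > 1/2" "z \<bullet> (a + d) > 1/2"
      using three_close_roots[OF F0] by blast
    have "a + b \<in> R" "a + c \<in> R" "a + d \<in> R"
      using F unfolding D4_frame_def pair_in_def by auto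
    with gt have sub1: "{a + b, a + c, a + d} \<subseteq> {r \<in> R. z \<bullet> r > 1/2}" by auto
    \<comment> \<open>A root in \<open>W\<close> differs from \<open>z\<close>, so the contact
      condition keeps its inner product with \<open>z\<close> at most 1/2.\<close>
    have sub2: "{r \<in> R. z \<bullet> r > 1/2} \<subseteq> R - W"
      using W z unfolding contact_configuration_def by force
    \<comment> \<open>Three distinct roots inside a set of at most three elements: both inclusions
      are equalities.\<close>
    have "{a + b, a + c, a + d} = R - W"
      using card_seteq[OF finM order_trans[OF sub1 sub2]] cardM D4_frame_roots_card[OF F] by simp
    with F sub1 sub2 show ?thesis by blast
  qed
  from missing[OF x] obtain a b c d where F: "D4_frame R a b c d"
    and M: "R - W = {a + b, a + c, a + d}" and closex: "{r \<in> R. x \<bullet> r > 1/2} = R - W" by blast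
  \<comment> \<open>The frame found for \<open>y\<close> is discarded; the close roots of
    \<open>y\<close> are \<open>R - W\<close>, so the frame of \<open>x\<close> serves for both
    points.\<close>
  have closey: "{r \<in> R. y \<bullet> r > 1/2} = R - W" using missing[OF y] by blast
  have cx: "x \<bullet> a > 1/2 \<and> x \<bullet> b > 0 \<and> x \<bullet> c > 0 \<and> x \<bullet> d > 0"
    by (rule close_roots_imp_coordinates[OF F norms(1) closex[unfolded M]])
  have cy: "y \<bullet> a > 1/2 \<and> y \<bullet> b > 0 \<and> y \<bullet> c > 0 \<and> y \<bullet> d > 0"
    by (rule close_roots_imp_coordinates[OF F norms(2) closey[unfolded M]])
  have "(x \<bullet> a) * (y \<bullet> a) > (1/2) * (1/2)"
    using cx cy by (intro mult_strict_mono) auto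
  moreover have "(x \<bullet> b) * (y \<bullet> b) > 0" "(x \<bullet> c) * (y \<bullet> c) > 0" "(x \<bullet> d) * (y \<bullet> d) > 0"
    using cx cy by auto
  ultimately have "(x \<bullet> a) * (y \<bullet> a) + (x \<bullet> b) * (y \<bullet> b) + (x \<bullet> c) * (y \<bullet> c) + (x \<bullet> d) * (y \<bullet> d) > 1/4"
    by linarith
  moreover have "x \<bullet> y = 2 * ((x \<bullet> a) * (y \<bullet> a) + (x \<bullet> b) * (y \<bullet> b) + (x \<bullet> c) * (y \<bullet> c) + (x \<bullet> d) * (y \<bullet> d))"
    using F unfolding D4_frame_def parseval_def by blast
  ultimately show False using xy by simp
qed

theorem proposition7p56:
  fixes W R :: "(real ^ 4) set"
  assumes "contact_configuration W"
    and "root_system R"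
    and "card (W \<inter> R) = 21"
  shows "W \<subseteq> R \<or> card W \<le> 22"
proof -
  have fin: "finite W" using assms(1) unfolding contact_configuration_def by blast
  have "card (W - R) \<le> 1"
    using at_most_one_extra_point[OF assms] fin by (simp add: card_le_Suc0_iff_eq)
  moreover have "card W = card (W \<inter> R) + card (W - R)"
    using card_Int_Diff[OF fin] by blast
  ultimately show ?thesis using assms(3) by simp
qed

end
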